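(* The maximum density of a $k$-multiplicative Sidon set is $\Theta(1/\log k)$. That is, there are constants $0<c_1\leq c_2$ such that for every integer $k\geq 2$: there exists a $k$-multiplicative Sidon set $A\subseteq\mathbb{N}$ whose density $\delta(A)$ exists and satisfies $\delta(A)\geq c_1/\log k$; and every $k$-multiplicative Sidon set $A\subseteq\mathbb{N}$ whose density exists satisfies $\delta(A)\leq c_2/\log k$.
   Context: $\mathbb{N}=\{1,2,\dots\}$ and $[n]=\{1,\dots,n\}$. A set $A\subseteq\mathbb{N}$ is $k$-multiplicative Sidon if for all $x,y\in A$ and all $a,b\in[k]$, $ax=by$ implies $a=b$ and $x=y$. The density of $A\subseteq\mathbb{N}$ is $\delta(A)=\lim_{n\to\infty}|A\cap[n]|/n$ if this limit exists (otherwise it is undefined). *)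

theory Defs
  imports Complex_Main
begin

text \<open>The positive integers are the elements of \<open>{1..}\<close> in type \<^typ>\<open>nat\<close>;
  \<open>0\<close> is excluded both from the sets and from the range of the multipliers.\<close>

definition mult_sidon :: "nat \<Rightarrow> nat set \<Rightarrow> bool" where
  "mult_sidon k A \<longleftrightarrow> A \<subseteq> {1..} \<and>
     (\<forall>x\<in>A. \<forall>y\<in>A. \<forall>a\<in>{1..k}. \<forall>b\<in>{1..k}. a * x = b * y \<longrightarrow> a = b \<and> x = y)"

text \<open>Density is a relation because the limit need not exist:
  \<open>has_density A d\<close> says that it exists and equals \<open>d\<close>.
  The term at \<open>n = 0\<close> is \<open>0 / 0 = 0\<close> and does not affect the limit.\<close>

definition has_density :: "nat set \<Rightarrow> real \<Rightarrow> bool" where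
  "has_density A d \<longleftrightarrow> (\<lambda>n. real (card (A \<inter> {1..n})) / real n) \<longlonglongrightarrow> d"

end

theory Submission
  imports Defs "HOL-Number_Theory.Totient" "HOL-Analysis.Harmonic_Numbers"
begin

text \<open>Upper bound: the dilates \<open>A, 2A, \<dots>, kA\<close> are pairwise disjoint and \<open>aA\<close> has density
  \<open>\<delta>(A)/a\<close>, so \<open>\<delta>(A)\<close> times the \<open>k\<close>-th harmonic number is at most 1. Lower bound: the integers
  coprime to \<open>k!\<close> form a \<open>k\<close>-multiplicative Sidon set, periodic of density
  \<open>\<Prod>\<^bsub>p\<le>k\<^esub> (1 - 1/p)\<close>. Mertens' estimates bound this product from below: Chebyshev's bound
  \<open>\<Prod>\<^bsub>p\<le>n\<^esub> p \<le> 4^n\<close> and the prime factorization of \<open>n!\<close> give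
  \<open>\<Sum>\<^bsub>p\<le>n\<^esub> ln p / p \<le> ln n + O(1)\<close>, and partial summation gives
  \<open>\<Sum>\<^bsub>p\<le>n\<^esub> 1/p \<le> ln (ln n) + O(1)\<close>.\<close>

section \<open>Upper bounds for sums over primes\<close>

lemma finite_primes_le [simp]: "finite {p::nat. prime p \<and> p \<le> n}"
  by (rule finite_subset[of _ "{..n}"]) auto

lemma primes_le_Suc:
  "{p::nat. prime p \<and> p \<le> Suc n} =
     (if prime (Suc n) then insert (Suc n) {p. prime p \<and> p \<le> n} else {p. prime p \<and> p \<le> n})"
  by (auto simp: le_Suc_eq)

lemma primes_le_2: "{p::nat. prime p \<and> p \<le> 2} = {2}"
  by (auto dest: prime_ge_2_nat)

lemma sum_primes_le_Suc:
  fixes f :: "nat \<Rightarrow> 'a::comm_monoid_add"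
  shows "(\<Sum>p | prime p \<and> p \<le> Suc n. f p) =
           (if prime (Suc n) then f (Suc n) else 0) + (\<Sum>p | prime p \<and> p \<le> n. f p)"
  by (simp add: primes_le_Suc)

section \<open>Chebyshev's bound on the product of the primes up to \<open>n\<close>\<close>

lemma prod_coprime_dvd:
  fixes f :: "'a \<Rightarrow> 'b::semiring_gcd"
  assumes "finite A" "\<And>x. x \<in> A \<Longrightarrow> f x dvd n"
    and "\<And>x y. x \<in> A \<Longrightarrow> y \<in> A \<Longrightarrow> x \<noteq> y \<Longrightarrow> coprime (f x) (f y)"
  shows "prod f A dvd n"
  using assms
proof (induction A rule: finite_induct)
  case (insert x A)
  have "coprime (f x) (prod f A)"
    using insert by (intro prod_coprime_right) auto
  with insert show ?case
    by (auto intro!: divides_mult)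
qed simp

text \<open>The two middle coefficients of row \<open>2 * m + 1\<close> are equal, and the whole row
  sums to \<open>2 * 4 ^ m\<close>.\<close>

lemma odd_binomial_le: "(2 * m + 1 choose m) \<le> 4 ^ m"
proof -
  have "2 * (2 * m + 1 choose m) = (\<Sum>k\<in>{m, m + 1}. 2 * m + 1 choose k)"
    using binomial_symmetric[of m "2 * m + 1"] by simp
  also have "\<dots> \<le> (\<Sum>k\<le>2 * m + 1. 2 * m + 1 choose k)"
    by (intro sum_mono2) auto
  also have "\<dots> = 2 * 4 ^ m"
    by (simp only: choose_row_sum) (simp add: power_mult)
  finally show ?thesis by simp
qed

text \<open>Erdos's strong induction: an even \<open>n > 2\<close> is not prime and reduces to
  \<open>n - 1\<close>. For \<open>n = 2 * m + 1\<close>, the primes above \<open>m + 1\<close> all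
  divide the middle binomial coefficient, and the others are covered by the induction hypothesis for
  \<open>m + 1\<close>.\<close>

lemma primorial_le: "(\<Prod>p | prime p \<and> p \<le> n. p) \<le> (4::nat) ^ n"
proof (induction n rule: less_induct)
  case (less n)
  consider "n \<le> 1" | "n = 2" | "n > 2" "even n" | m where "m \<ge> 1" "n = 2 * m + 1"
  proof (cases "n \<le> 2 \<or> even n")
    case True
    then show ?thesis using that(1-3) by linarith
  next
    case False
    then obtain m where "n = 2 * m + 1" by (blast elim: oddE)
    with False that(4)[of m] show ?thesis by simp
  qed
  then show ?case
  proof cases
    case 1
    then have "{p::nat. prime p \<and> p \<le> n} = {}"
      by (auto dest!: prime_gt_1_nat)
    then show ?thesis by (simp only: prod.empty) simp
  next
    case 2
    then show ?thesis by (simp add: primes_le_2)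
  next
    case 3
    then obtain m where m: "n = Suc m" by (cases n) auto
    from 3 have "\<not> prime n" using prime_odd_nat by blast
    then have "(\<Prod>p | prime p \<and> p \<le> n. p) = (\<Prod>p | prime p \<and> p \<le> m. p)"
      by (simp add: m primes_le_Suc)
    also have "\<dots> \<le> 4 ^ m" using less m by simp
    also have "\<dots> \<le> 4 ^ n" using m by simp
    finally show ?thesis .
  next
    case (4 m)
    let ?B = "{p. prime p \<and> m + 1 < p \<and> p \<le> 2 * m + 1}"
    have fin: "finite ?B" by (rule finite_subset[of _ "{..2 * m + 1}"]) auto
    have "p dvd (2 * m + 1 choose m)" if "p \<in> ?B" for p
    proof -
      have "p dvd fact (2 * m + 1)" using that by (simp add: prime_dvd_fact_iff del: fact_Suc)
      also have "fact (2 * m + 1) = fact m * fact (m + 1) * (2 * m + 1 choose m)"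
        using binomial_fact_lemma[of m "2 * m + 1"] by simp
      \<comment> \<open>Since \<open>p > m + 1\<close>, it divides neither factorial on the right,
        so it divides the binomial coefficient.\<close>
      finally show ?thesis
        using that by (simp add: prime_dvd_mult_iff prime_dvd_fact_iff del: fact_Suc)
    qed
    then have "\<Prod>?B dvd (2 * m + 1 choose m)"
      using fin by (intro prod_coprime_dvd) (auto intro: primes_coprime)
    then have B: "\<Prod>?B \<le> 4 ^ m"
      using odd_binomial_le[of m] by (auto dest!: dvd_imp_le)
    have "{p. prime p \<and> p \<le> n} = {p. prime p \<and> p \<le> m + 1} \<union> ?B"
      using 4 by auto
    then have "(\<Prod>p | prime p \<and> p \<le> n. p) = (\<Prod>p | prime p \<and> p \<le> m + 1. p) * \<Prod>?B"
      using fin by (simp only:) (rule prod.union_disjoint, auto)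
    also have "\<dots> \<le> 4 ^ (m + 1) * 4 ^ m"
      using less[of "m + 1"] 4 B by (intro mult_le_mono) auto
    also have "\<dots> = 4 ^ n" by (simp add: 4 mult_2 power_add)
    finally show ?thesis .
  qed
qed

section \<open>Mertens' bound for the sum of \<open>ln p / p\<close>\<close>

lemma power_div_dvd_fact:
  assumes "p > 0"
  shows "p ^ (n div p) dvd (fact n :: nat)"
proof (induction n)
  case (Suc n)
  show ?case
  proof (cases "p dvd Suc n")
    case True
    then have "Suc n div p = Suc (n div p)"
      by (simp add: div_Suc mod_eq_0_iff_dvd)
    with mult_dvd_mono[OF True Suc] show ?thesis by simp
  next
    case False
    then have "Suc n div p = n div p"
      by (simp add: div_Suc mod_eq_0_iff_dvd)
    with Suc show ?thesis by (simp add: dvd_mult)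
  qed
qed (use assms in simp)

text \<open>Only the first term of Legendre's formula for the exponent of \<open>p\<close> in
  \<open>n!\<close> is kept; this suffices for an upper bound on the prime sum.\<close>

lemma sum_ln_div_le_ln_fact:
  "(\<Sum>p | prime p \<and> p \<le> n. real (n div p) * ln (real p)) \<le> ln (fact n)"
proof -
  let ?P = "{p::nat. prime p \<and> p \<le> n}"
  have "(\<Prod>p\<in>?P. p ^ (n div p)) dvd fact n"
    by (rule prod_coprime_dvd)
      (auto intro: power_div_dvd_fact primes_coprime prime_gt_0_nat)
  then have le: "(\<Prod>p\<in>?P. p ^ (n div p)) \<le> fact n"
    by (rule dvd_imp_le) simp
  have "(\<Sum>p\<in>?P. real (n div p) * ln (real p)) = ln (\<Prod>p\<in>?P. real p ^ (n div p))"
    by (subst ln_prod) (auto simp: ln_realpow prime_gt_0_nat)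
  also have "(\<Prod>p\<in>?P. real p ^ (n div p)) = real (\<Prod>p\<in>?P. p ^ (n div p))"
    by simp
  also have "ln \<dots> \<le> ln (real (fact n))"
    using le by (intro ln_mono)
      (auto intro!: prod_pos prime_gt_0_nat simp: of_nat_le_iff simp del: of_nat_prod of_nat_fact)
  finally show ?thesis by simp
qed

lemma sum_ln_primes_le: "(\<Sum>p | prime p \<and> p \<le> n. ln (real p)) \<le> real n * ln 4"
proof -
  let ?P = "{p::nat. prime p \<and> p \<le> n}"
  have "(\<Sum>p\<in>?P. ln (real p)) = ln (real (\<Prod>p\<in>?P. p))"
    by (subst of_nat_prod, subst ln_prod) (auto simp: prime_gt_0_nat)
  also have "\<dots> \<le> ln (real (4 ^ n))"
    using primorial_le[of n] by (intro ln_mono)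
      (auto intro!: prod_pos prime_gt_0_nat simp: of_nat_le_iff simp del: of_nat_prod of_nat_power)
  also have "\<dots> = real n * ln 4" by (simp add: ln_realpow)
  finally show ?thesis .
qed

text \<open>Replacing \<open>n div p\<close> by \<open>n / p - 1\<close> costs the sum of
  \<open>ln p\<close>, which Chebyshev's bound limits to \<open>n * ln 4\<close>; the rest follows
  from \<open>n! \<le> n ^ n\<close>.\<close>

lemma sum_ln_over_primes_le:
  assumes "n \<ge> 1"
  shows "(\<Sum>p | prime p \<and> p \<le> n. ln (real p) / real p) \<le> ln (real n) + ln 4"
proof -
  let ?P = "{p::nat. prime p \<and> p \<le> n}"
  have "real n * (\<Sum>p\<in>?P. ln (real p) / real p) - (\<Sum>p\<in>?P. ln (real p))
          = (\<Sum>p\<in>?P. (real n / real p - 1) * ln (real p))"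
    by (simp add: sum_distrib_left sum_subtractf algebra_simps)
  also have "\<dots> \<le> (\<Sum>p\<in>?P. real (n div p) * ln (real p))"
  proof (intro sum_mono mult_right_mono)
    fix p assume "p \<in> ?P"
    then show "0 \<le> ln (real p)"
      using prime_gt_0_nat[of p] by auto
    have "real (n div p) = of_int \<lfloor>real n / real p\<rfloor>"
      by (simp add: floor_divide_of_nat_eq)
    then show "real n / real p - 1 \<le> real (n div p)" by linarith
  qed
  also have "\<dots> \<le> ln (fact n)" by (rule sum_ln_div_le_ln_fact)
  also have "\<dots> \<le> ln (real (n ^ n))"
    using fact_le_power[of n, where ?'a = real] by (intro ln_mono) auto
  also have "\<dots> = real n * ln (real n)"
    using assms by (simp add: ln_realpow)
  finally have "real n * (\<Sum>p\<in>?P. ln (real p) / real p) \<le> real n * (ln (real n) + ln 4)"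
    using sum_ln_primes_le[of n] by (simp add: algebra_simps)
  with assms show ?thesis by simp
qed

section \<open>Mertens' bound for the sum of \<open>1 / p\<close>\<close>

text \<open>Partial summation, with the boundary term kept on the left so that it becomes an induction.\<close>

lemma sum_inverse_primes_aux:
  fixes n :: nat
  defines "S \<equiv> \<lambda>n::nat. \<Sum>p | prime p \<and> p \<le> n. ln (real p) / real p"
    and "T \<equiv> \<lambda>n::nat. \<Sum>p | prime p \<and> p \<le> n. 1 / real p"
  assumes "n \<ge> 2"
  shows "T n - S n / ln (real n) \<le> ln (ln (real n)) - ln 4 / ln (real n) + (2 - ln (ln 2))"
  using assms(3)
proof (induction n rule: dec_induct)
  case base
  \<comment> \<open>Both sides vanish at \<open>n = 2\<close>; this fixes the constant
    \<open>2 - ln (ln 2)\<close>.\<close>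
  have "ln 4 = 2 * ln (2::real)"
    using ln_realpow[of 2 2] by simp
  then show ?case by (simp add: S_def T_def primes_le_2)
next
  case (step n)
  define a b where "a = ln (real n)" and "b = ln (real (Suc n))"
  have a: "a > 0" and ab: "a \<le> b" using step by (auto simp: a_def b_def)
  define e where "e = (if prime (Suc n) then 1 / real (Suc n) else 0)"
  have "T (Suc n) = e + T n" "S (Suc n) = e * b + S n"
    by (simp_all add: T_def S_def sum_primes_le_Suc e_def b_def)
  \<comment> \<open>A new prime contributes \<open>e\<close> to \<open>T\<close> and
    \<open>e * b\<close> to \<open>S\<close>, so it cancels here and only the change of denominator
    from \<open>a\<close> to \<open>b\<close> remains.\<close>
  then have "T (Suc n) - S (Suc n) / b = T n - S n / b"
    using a ab by (simp add: add_divide_distrib)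
  also have "\<dots> = (T n - S n / a) + S n * (1 / a - 1 / b)"
    by (simp add: algebra_simps)
  also have "S n * (1 / a - 1 / b) \<le> (a + ln 4) * (1 / a - 1 / b)"
    using sum_ln_over_primes_le[of n] step a ab
    by (intro mult_right_mono) (auto simp: S_def a_def frac_le)
  also have "\<dots> = 1 - a / b + ln 4 / a - ln 4 / b"
    using a ab by (simp add: field_simps)
  \<comment> \<open>The resulting increment \<open>ln b - ln a\<close> telescopes to
    \<open>ln (ln n)\<close>, as the \<open>ln 4\<close> terms also telescope.\<close>
  also have "1 - a / b \<le> - ln (a / b)"
    using ln_le_minus_one[of "a / b"] a ab by simp
  also have "- ln (a / b) = ln b - ln a"
    using a ab by (simp add: ln_div)
  finally show ?case
    using step.IH by (simp add: a_def b_def)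
qed

text \<open>The boundary term is at most \<open>1 + ln 4 / ln n\<close>: its second summand cancels
  against the auxiliary bound, and the 1 raises the constant from 2 to 3.\<close>

lemma sum_inverse_primes_le:
  assumes "n \<ge> 2"
  shows "(\<Sum>p | prime p \<and> p \<le> n. 1 / real p) \<le> ln (ln (real n)) + (3 - ln (ln 2))"
proof -
  have "(\<Sum>p | prime p \<and> p \<le> n. ln (real p) / real p) / ln (real n)
          \<le> (ln (real n) + ln 4) / ln (real n)"
    using assms by (intro divide_right_mono sum_ln_over_primes_le) auto
  also have "\<dots> = 1 + ln 4 / ln (real n)"
    using assms by (simp add: field_simps)
  finally show ?thesis using sum_inverse_primes_aux[OF assms] by linarith
qed

section \<open>Lower bound for the Mertens product\<close>

lemma sum_telescope_le:
  "n \<ge> 1 \<Longrightarrow> (\<Sum>p=2..n. 1 / (real p - 1) - 1 / real p) = 1 - 1 / real n"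
  by (induction n rule: dec_induct) simp_all

text \<open>Each factor equals \<open>1 / (1 + 1 / (p - 1))\<close>, hence is at least
  \<open>exp (- 1 / (p - 1))\<close>. Passing from \<open>1 / p\<close> to
  \<open>1 / (p - 1)\<close> in the exponent costs at most 1 in total, by telescoping over all
  integers up to \<open>k\<close>; hence 4 instead of 3.\<close>

lemma prod_one_minus_inverse_primes_ge:
  assumes "k \<ge> 2"
  shows "(\<Prod>p | prime p \<and> p \<le> k. 1 - 1 / real p) \<ge> exp (ln (ln 2) - 4) / ln (real k)"
proof -
  let ?P = "{p::nat. prime p \<and> p \<le> k}"
  have P: "p \<ge> 2" if "p \<in> ?P" for p using that prime_ge_2_nat by auto
  have "(\<Sum>p\<in>?P. 1 / (real p - 1) - 1 / real p) \<le> (\<Sum>p=2..k. 1 / (real p - 1) - 1 / real p)"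
    using P by (intro sum_mono2) (auto simp: frac_le)
  also have "\<dots> \<le> 1" using assms by (simp add: sum_telescope_le)
  finally have "(\<Sum>p\<in>?P. 1 / (real p - 1)) \<le> ln (ln (real k)) + (4 - ln (ln 2))"
    using sum_inverse_primes_le[OF assms] by (simp add: sum_subtractf)
  then have "exp (- ln (ln (real k)) - (4 - ln (ln 2))) \<le> exp (- (\<Sum>p\<in>?P. 1 / (real p - 1)))"
    by simp
  also have "\<dots> = (\<Prod>p\<in>?P. exp (- (1 / (real p - 1))))"
    by (simp add: exp_sum sum_negf[symmetric])
  also have "\<dots> \<le> (\<Prod>p\<in>?P. 1 - 1 / real p)"
  proof (intro prod_mono conjI)
    fix p assume "p \<in> ?P"
    then have p: "real p \<ge> 2" using P by fastforce
    have "exp (- (1 / (real p - 1))) = 1 / exp (1 / (real p - 1))"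
      by (simp add: exp_minus field_simps)
    also have "\<dots> \<le> 1 / (1 + 1 / (real p - 1))"
      using p by (intro divide_left_mono) (auto intro!: mult_pos_pos add_pos_nonneg)
    also have "\<dots> = 1 - 1 / real p" using p by (simp add: field_simps)
    finally show "exp (- (1 / (real p - 1))) \<le> 1 - 1 / real p" .
  qed simp
  finally show ?thesis
    using assms by (simp add: exp_diff exp_minus divide_simps mult_ac)
qed

section \<open>Integers coprime to a factorial\<close>

text \<open>Coprimality to \<open>m\<close> has period \<open>m\<close>, and the first period
  contains \<open>totient m\<close> solutions.\<close>

lemma card_coprime_le_add:
  "card {x\<in>{1..m + n}. coprime x m} = totient m + card {x\<in>{1..n}. coprime x m}"
proof -
  have cop: "coprime (m + y) m \<longleftrightarrow> coprime y m" for y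
    by (simp add: coprime_iff_gcd_eq_1 gcd.commute)
  have "{x\<in>{1..m + n}. coprime x m}
          = {x\<in>{0<..m}. coprime x m} \<union> (+) m ` {x\<in>{1..n}. coprime x m}" (is "_ = ?B \<union> ?C")
  proof (intro equalityI subsetI)
    fix x assume x: "x \<in> {x\<in>{1..m + n}. coprime x m}"
    show "x \<in> ?B \<union> ?C"
    proof (cases "x \<le> m")
      case False
      then obtain y where "x = m + y" using le_Suc_ex nat_le_linear by blast
      with x False cop show ?thesis by auto
    qed (use x in auto)
  qed (auto simp: cop)
  moreover have "card (?B \<union> ?C) = card ?B + card ?C"
    by (intro card_Un_disjoint) auto
  ultimately show ?thesis
    by (simp add: card_image totient_def totatives_def)
qed

lemma card_coprime_le_bounds:
  assumes "m > 0"
  shows "(n div m) * totient m \<le> card {x\<in>{1..n}. coprime x m}"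
    and "card {x\<in>{1..n}. coprime x m} \<le> (n div m) * totient m + m"
proof -
  have eq: "card {x\<in>{1..q * m + r}. coprime x m} = q * totient m + card {x\<in>{1..r}. coprime x m}"
    for q r
  proof (induction q)
    case (Suc q)
    then show ?case
      using card_coprime_le_add[of m "q * m + r"] by (simp add: add_ac)
  qed simp
  have "card {x\<in>{1..n mod m}. coprime x m} \<le> card {1..n mod m}"
    by (intro card_mono) auto
  also have "\<dots> \<le> m" using assms by (simp add: less_imp_le)
  finally show "(n div m) * totient m \<le> card {x\<in>{1..n}. coprime x m}"
    and "card {x\<in>{1..n}. coprime x m} \<le> (n div m) * totient m + m"
    using eq[of "n div m" "n mod m"] by simp_all
qed

text \<open>The incomplete last period changes the count by at most \<open>m\<close>, so the error
  in the ratio is at most \<open>m / n\<close>.\<close>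

lemma has_density_coprime:
  assumes "m > 0"
  shows "has_density {x. x \<ge> 1 \<and> coprime x m} (real (totient m) / real m)"
proof -
  define c where "c = real (totient m) / real m"
  define f where "f n = real (card {x\<in>{1..n}. coprime x m})" for n
  have c: "0 \<le> c" "c \<le> 1" using assms totient_le[of m] by (auto simp: c_def)
  have lim: "(\<lambda>n. real m / real n) \<longlonglongrightarrow> 0"
    by (rule lim_const_over_n)
  have "f n \<ge> real n * c - real m" and "f n \<le> real n * c + real m" for n
  proof -
    have n: "real n = real (n div m) * real m + real (n mod m)"
      by (metis div_mult_mod_eq of_nat_add of_nat_mult)
    have "real (n mod m) \<le> real m" using assms by (simp add: less_imp_le)
    then have r: "0 \<le> real (n mod m) * c" "real (n mod m) * c \<le> real m"
      using c mult_mono[of "real (n mod m)" "real m" c 1] by auto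
    have "real n * c = real (n div m) * totient m + real (n mod m) * c"
      by (subst n) (use assms in \<open>simp add: c_def field_simps\<close>)
    moreover have "real ((n div m) * totient m) \<le> f n" "f n \<le> real ((n div m) * totient m + m)"
      using card_coprime_le_bounds[OF assms, of n] unfolding f_def of_nat_le_iff by auto
    ultimately show "f n \<ge> real n * c - real m" "f n \<le> real n * c + real m"
      using r by simp_all
  qed
  then have le: "norm (f n / real n - c) \<le> real m / real n" if "n > 0" for n
    using that by (simp add: abs_le_iff field_simps)
  have "(\<lambda>n. f n / real n - c) \<longlonglongrightarrow> 0"
    by (rule Lim_null_comparison[OF _ lim], rule eventually_sequentiallyI[of 1], rule le) simp
  then have "(\<lambda>n. f n / real n) \<longlonglongrightarrow> c" by (rule LIM_zero_cancel)
  moreover have "{x. x \<ge> 1 \<and> coprime x m} \<inter> {1..n} = {x\<in>{1..n}. coprime x m}" for n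
    by auto
  ultimately show ?thesis by (simp add: has_density_def f_def c_def)
qed

text \<open>Every multiplier in \<open>{1..k}\<close> divides \<open>k!\<close>, so
  \<open>a * x = b * y\<close> has \<open>x\<close> coprime to \<open>b\<close> and \<open>y\<close>
  coprime to \<open>a\<close>. Then \<open>x\<close> and \<open>y\<close> divide each other.\<close>

lemma mult_sidon_coprime_fact: "mult_sidon k {x. x \<ge> 1 \<and> coprime x (fact k)}"
  unfolding mult_sidon_def
proof (intro conjI ballI impI)
  fix x y a b
  assume *: "x \<in> {x. 1 \<le> x \<and> coprime x (fact k)}" "y \<in> {x. 1 \<le> x \<and> coprime x (fact k)}"
    "a \<in> {1..k}" "b \<in> {1..k}" "a * x = b * y"
  then have "coprime x b" "coprime y a"
    by (auto intro: coprime_divisors[OF dvd_refl dvd_fact])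
  with * show "a = b" "x = y"
    using coprime_crossproduct_nat[of a y b x] by (auto simp: coprime_commute)
qed auto

lemma totient_fact_ratio:
  "real (totient (fact k)) / real (fact k) = (\<Prod>p | prime p \<and> p \<le> k. 1 - 1 / real p)"
proof -
  have "prime_factors (fact k :: nat) = {p. prime p \<and> p \<le> k}"
    by (auto simp: prime_factors_dvd prime_dvd_fact_iff)
  then show ?thesis by (simp add: totient_formula2)
qed

section \<open>Disjointness of dilates\<close>

text \<open>Finite form of the disjointness: truncating \<open>A\<close> at \<open>n div a\<close>
  keeps its dilate by \<open>a\<close> inside \<open>{1..n}\<close>.\<close>

lemma mult_sidon_sum_card_le:
  assumes "mult_sidon k A"
  shows "(\<Sum>a=1..k. card (A \<inter> {1..n div a})) \<le> n"
proof -
  let ?D = "\<lambda>a. (*) a ` (A \<inter> {1..n div a})"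
  have "(\<Sum>a=1..k. card (A \<inter> {1..n div a})) = (\<Sum>a=1..k. card (?D a))"
    by (intro sum.cong refl card_image[symmetric]) (auto simp: inj_on_def)
  also have "\<dots> = card (\<Union>a\<in>{1..k}. ?D a)"
  proof (intro card_UN_disjoint[symmetric] ballI impI)
    fix a b assume ab: "a \<in> {1..k}" "b \<in> {1..k}" "a \<noteq> b"
    have "a * x \<noteq> b * y" if "x \<in> A" "y \<in> A" for x y
      using assms ab that unfolding mult_sidon_def by blast
    then show "?D a \<inter> ?D b = {}" by blast
  qed auto
  also have "\<dots> \<le> card {1..n}"
  proof (intro card_mono subsetI)
    fix z assume "z \<in> (\<Union>a\<in>{1..k}. ?D a)"
    then obtain a x where "a \<ge> 1" "x \<ge> 1" "x \<le> n div a" "z = a * x" by auto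
    then show "z \<in> {1..n}"
      by (auto simp: less_eq_div_iff_mult_less_eq mult.commute)
  qed simp
  finally show ?thesis by simp
qed

text \<open>The finite inequality divided by \<open>n\<close> passes to the limit termwise, the term
  for \<open>a\<close> tending to \<open>d / a\<close>.\<close>

lemma mult_sidon_density_harm_le:
  assumes "mult_sidon k A" "has_density A d"
  shows "d * harm k \<le> 1"
proof -
  define F where "F n = real (card (A \<inter> {1..n}))" for n
  have F: "(\<lambda>n. F n / real n) \<longlonglongrightarrow> d"
    using assms(2) by (simp add: has_density_def F_def)
  \<comment> \<open>Along the multiples of \<open>k!\<close> all the quotients \<open>n / a\<close> are integers.\<close>
  define N where "N m = Suc m * fact k" for m
  have sub: "(\<lambda>m. F (N m div a) / real (N m div a) / real a) \<longlonglongrightarrow> d / real a" if "a \<in> {1..k}" for a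
  proof -
    have "a dvd fact k" using that by (intro dvd_fact) auto
    then obtain c where c: "fact k = a * c" by blast
    then have "c > 0" by (metis fact_nonzero gr0I mult_0_right)
    moreover have "N m div a = Suc m * c" for m
      using that by (simp add: N_def c mult.left_commute[of _ a] del: mult_Suc)
    ultimately have "strict_mono (\<lambda>m. N m div a)"
      by (simp add: strict_mono_def)
    then have "(\<lambda>m. F (N m div a) / real (N m div a)) \<longlonglongrightarrow> d"
      using LIMSEQ_subseq_LIMSEQ[OF F, of "\<lambda>m. N m div a"] by (simp add: o_def)
    then show ?thesis by (intro tendsto_divide tendsto_const) (use that in auto)
  qed
  have "(\<Sum>a=1..k. F (N m div a) / real (N m div a) / real a) \<le> 1" for m
  proof -
    have N: "N m > 0" by (simp add: N_def)
    have "(\<Sum>a=1..k. F (N m div a) / real (N m div a) / real a) = (\<Sum>a=1..k. F (N m div a)) / real (N m)"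
      unfolding sum_divide_distrib
    proof (intro sum.cong refl)
      fix a assume a: "a \<in> {1..k}"
      then have "a dvd N m" unfolding N_def by (intro dvd_mult dvd_fact) auto
      then have "real (N m div a) * real a = real (N m)"
        by (metis dvd_div_mult_self of_nat_mult)
      then show "F (N m div a) / real (N m div a) / real a = F (N m div a) / real (N m)"
        by simp
    qed
    also have "\<dots> \<le> real (N m) / real (N m)"
      using mult_sidon_sum_card_le[OF assms(1), of "N m"]
      by (intro divide_right_mono) (auto simp: F_def simp flip: of_nat_sum)
    finally show ?thesis using N by simp
  qed
  then have "(\<Sum>a=1..k. d / real a) \<le> 1"
    by (intro LIMSEQ_le_const2[OF tendsto_sum[OF sub]]) auto
  then show ?thesis
    by (simp add: harm_def sum_distrib_left field_simps)
qed

theorem theorem3: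
  shows "\<exists>c1 c2 :: real. 0 < c1 \<and> c1 \<le> c2 \<and>
    (\<forall>k::nat. k \<ge> 2 \<longrightarrow>
      (\<exists>A d. mult_sidon k A \<and> has_density A d \<and> d \<ge> c1 / ln (real k)) \<and>
      (\<forall>A d. mult_sidon k A \<and> has_density A d \<longrightarrow> d \<le> c2 / ln (real k)))"
proof (intro exI conjI allI impI)
  \<comment> \<open>The constants are \<open>c1 = exp (ln (ln 2) - 4)\<close>, from the Mertens
    product, and \<open>c2 = 1\<close>, from the harmonic sum.\<close>
  show "0 < exp (ln (ln 2) - 4 :: real)" by simp
  have "ln (ln 2) \<le> (4::real)"
    using ln_le_minus_one[of "ln 2"] ln_le_minus_one[of 2] by simp
  then show "exp (ln (ln 2) - 4) \<le> (1::real)" by simp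
next
  fix k :: nat assume k: "k \<ge> 2"
  show "mult_sidon k {x. x \<ge> 1 \<and> coprime x (fact k)}"
    by (rule mult_sidon_coprime_fact)
  show "has_density {x. x \<ge> 1 \<and> coprime x (fact k)} (real (totient (fact k)) / real (fact k))"
    by (rule has_density_coprime) simp
  show "real (totient (fact k)) / real (fact k) \<ge> exp (ln (ln 2) - 4) / ln (real k)"
    using prod_one_minus_inverse_primes_ge[OF k] by (simp only: totient_fact_ratio)
next
  fix k :: nat and A d assume k: "k \<ge> 2" and A: "mult_sidon k A \<and> has_density A d"
  \<comment> \<open>The sign of \<open>d\<close> permits multiplying
    \<open>ln k \<le> harm k\<close> by it.\<close>
  have "d \<ge> 0"
    using A by (auto simp: has_density_def intro: LIMSEQ_le_const)
  then have "d * ln (real k) \<le> d * harm k"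
    using k by (intro mult_left_mono order.trans[OF _ ln_le_harm[of k]]) auto
  also have "\<dots> \<le> 1" using A mult_sidon_density_harm_le by blast
  finally show "d \<le> 1 / ln (real k)" using k by (simp add: field_simps)
qed

end
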